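(* For non-empty rooted trees $P,R,S$, let $T_1=T_1(P,R,S)$ be the rooted tree whose root $a$ has exactly two children, a node $y$ and the root of a copy of $S$, where $y$ has exactly two children, the root of a copy of $P$ and the root of a copy of $R$. Let $T_2=T_2(P,R,S)$ be the rooted tree whose root $a$ has exactly two children, the root of a copy of $P$ and a node $z$, where $z$ has exactly two children, the root of a copy of $R$ and the root of a copy of $S$. There exist non-empty rooted trees $P,R,S$, with $P$ not isomorphic to $S$, such that every largest common minor $T_\mu$ of $T_1$ and $T_2$ has size $|T_\mu|=|T_1|-1$, while every smallest common supertree $T_\sigma$ of $T_1$ and $T_2$ under minor embeddings has size $|T_\sigma|>|T_1|+1$. In particular, the equality $|T_\sigma|=|T_1|+|T_2|-|T_\mu|$ does not hold for all pairs of trees $T_1,T_2$.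
   Context: A (rooted) tree is a finite directed graph $T=(V(T),E(T))$, without loops, which is either empty or has a distinguished node $r$ (the root) such that for every other node $v$ there is exactly one directed path from $r$ to $v$; arcs point from parent to child. Trees are unordered. The size $|T|$ is the number of nodes of $T$. A tree $S$ is a minor of a tree $T$ if there is an injective map $f:V(S)\to V(T)$ (a minor embedding $f:S\to T$) such that for every arc $(u,v)\in E(S)$ there is a directed path from $f(u)$ to $f(v)$ in $T$ with no intermediate node in $f(V(S))$. A largest common minor of trees $T_1,T_2$ is a tree that is a minor of both and has the largest size among all such trees. A smallest common supertree of $T_1,T_2$ under minor embeddings is a tree of which both $T_1$ and $T_2$ are minors and that has the least size among all such trees. *)

theory Defs
  imports "Graph_Theory.Graph_Theory"
begin

text \<open>
  Directed paths are the library's \<open>awalk\<close>s, so they may repeat nodes. With this reading the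
  uniqueness requirement below excludes all cycles, including arcs back into the root.
\<close>

definition is_root :: "'a pair_pre_digraph \<Rightarrow> 'a \<Rightarrow> bool" where
  "is_root T r \<longleftrightarrow> r \<in> pverts T \<and>
     (\<forall>v\<in>pverts T. v \<noteq> r \<longrightarrow> (\<exists>!p. pre_digraph.awalk (with_proj T) r p v))"

text \<open>\<open>pair_digraph\<close> says: finite, well-formed and without loops. The graph may be empty.\<close>

definition rooted_tree :: "'a pair_pre_digraph \<Rightarrow> bool" where
  "rooted_tree T \<longleftrightarrow> pair_digraph T \<and> (pverts T = {} \<or> (\<exists>r. is_root T r))"

text \<open>A non-empty tree has only one root, so the root need not be carried as extra data.\<close>

definition tree_root :: "'a pair_pre_digraph \<Rightarrow> 'a" where
  "tree_root T = (THE r. is_root T r)"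

definition tree_size :: "'a pair_pre_digraph \<Rightarrow> nat" where
  "tree_size T = card (pverts T)"

text \<open>\<open>inner_verts p\<close> lists the intermediate nodes of \<open>p\<close>.\<close>

definition minor_embedding ::
  "('a \<Rightarrow> 'b) \<Rightarrow> 'a pair_pre_digraph \<Rightarrow> 'b pair_pre_digraph \<Rightarrow> bool" where
  "minor_embedding f S T \<longleftrightarrow>
     f ` pverts S \<subseteq> pverts T \<and> inj_on f (pverts S) \<and>
     (\<forall>(u, v)\<in>parcs S. \<exists>p. pre_digraph.awalk (with_proj T) (f u) p (f v) \<and>
        set (pre_digraph.inner_verts (with_proj T) p) \<inter> f ` pverts S = {})"

definition is_minor :: "'a pair_pre_digraph \<Rightarrow> 'b pair_pre_digraph \<Rightarrow> bool" where
  "is_minor S T \<longleftrightarrow> (\<exists>f. minor_embedding f S T)"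

text \<open>
  From here on all nodes are natural numbers. Every finite graph has an isomorphic copy of this
  kind, so comparing sizes over such trees amounts to comparing them over all trees.
\<close>

type_synonym ntree = "nat pair_pre_digraph"

definition common_minor :: "ntree \<Rightarrow> ntree \<Rightarrow> ntree \<Rightarrow> bool" where
  "common_minor T1 T2 M \<longleftrightarrow> rooted_tree M \<and> is_minor M T1 \<and> is_minor M T2"

definition largest_common_minor :: "ntree \<Rightarrow> ntree \<Rightarrow> ntree \<Rightarrow> bool" where
  "largest_common_minor T1 T2 M \<longleftrightarrow> common_minor T1 T2 M \<and>
     (\<forall>M'. common_minor T1 T2 M' \<longrightarrow> tree_size M' \<le> tree_size M)"

definition common_supertree :: "ntree \<Rightarrow> ntree \<Rightarrow> ntree \<Rightarrow> bool" where
  "common_supertree T1 T2 U \<longleftrightarrow> rooted_tree U \<and> is_minor T1 U \<and> is_minor T2 U"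

definition smallest_common_supertree :: "ntree \<Rightarrow> ntree \<Rightarrow> ntree \<Rightarrow> bool" where
  "smallest_common_supertree T1 T2 U \<longleftrightarrow> common_supertree T1 T2 U \<and>
     (\<forall>U'. common_supertree T1 T2 U' \<longrightarrow> tree_size U \<le> tree_size U')"

text \<open>
  For non-empty trees, \<open>join A B\<close> has root \<open>0\<close> with exactly two children, namely the roots of
  disjoint copies of \<open>A\<close> (on odd numbers) and \<open>B\<close> (on positive even numbers).
\<close>

definition join :: "ntree \<Rightarrow> ntree \<Rightarrow> ntree" where
  "join A B =
     \<lparr> pverts = {0} \<union> (\<lambda>v. 2 * v + 1) ` pverts A \<union> (\<lambda>v. 2 * v + 2) ` pverts B,
       parcs = {(0, 2 * tree_root A + 1), (0, 2 * tree_root B + 2)}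
         \<union> (\<lambda>(u, v). (2 * u + 1, 2 * v + 1)) ` parcs A
         \<union> (\<lambda>(u, v). (2 * u + 2, 2 * v + 2)) ` parcs B \<rparr>"

text \<open>The inner \<open>join\<close> supplies the node called $y$ (respectively $z$) together with its children.\<close>

definition tree_T1 :: "ntree \<Rightarrow> ntree \<Rightarrow> ntree \<Rightarrow> ntree" where
  "tree_T1 P R S = join (join P R) S"

definition tree_T2 :: "ntree \<Rightarrow> ntree \<Rightarrow> ntree \<Rightarrow> ntree" where
  "tree_T2 P R S = join P (join R S)"

end

theory Submission
  imports Defs
begin

text \<open>
  A minor embedding of trees is an embedding of the strict ancestor orders, so the nodes of the two
  trees can be regarded as subsets of the nodes of a common supertree \<open>U\<close>. Write $p, r, s$ for the
  sizes of $P, R, S$ and let $p + 2 \<le> s < p + r$. If \<open>U\<close> has at most one node more than $T_1$, then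
  every node of a copy of $T_1$ or $T_2$ has at most one descendant in \<open>U\<close> outside that copy.
  Counting descendants shows that $z$ lies outside the copy of $T_1$, that $y$ lies outside the copy
  of $T_2$, and that the two roots coincide; so both copies of $P + R + S$ occupy the same set of
  nodes. It has too few elements for $y$ and $z$ to have disjoint sets of descendants, so $y$ and $z$
  are comparable, and as $p < s$ the node $y$ is below $z$. Taking complements, $P$ in $T_2$ is part
  of $S$ in $T_1$, hence a whole component, which contradicts $p < s$. The same counting applies to
  $T_1$ and $T_2$ inside $T_2$, so they are not isomorphic and a common minor has fewer nodes than
  $T_1$; contracting $y$ or $z$ loses just one. The sizes $1, 3, 3$ satisfy the inequalities.
\<close>

section \<open>Rooted trees and their ancestor order\<close>

lemma awalk_with_proj_iff:
  "pre_digraph.awalk (with_proj T) u p v \<longleftrightarrow> u \<in> pverts T \<and> set p \<subseteq> parcs T \<and> pcas u p v"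
  by (simp add: pre_digraph.awalk_def cas_with_proj_eq)

lemma pcas_append: "pcas u (p @ q) v \<longleftrightarrow> (\<exists>w. pcas u p w \<and> pcas w q v)"
  by (induction p arbitrary: u) auto

lemma pcas_imp_rtrancl: "pcas u p v \<Longrightarrow> set p \<subseteq> E \<Longrightarrow> (u, v) \<in> E\<^sup>*"
  by (induction p arbitrary: u) (auto intro: converse_rtrancl_into_rtrancl)

lemma rtrancl_imp_pcas: "(u, v) \<in> E\<^sup>* \<Longrightarrow> \<exists>p. set p \<subseteq> E \<and> pcas u p v"
proof (induction rule: converse_rtrancl_induct)
  case base
  show ?case by (rule exI[of _ "[]"]) simp
next
  case (step u w)
  then obtain p where "set p \<subseteq> E" "pcas w p v" by blast
  with step.hyps(1) show ?case by (intro exI[of _ "(u, w) # p"]) auto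
qed

text \<open>Uniqueness of walks from the root is replaced by local conditions: unique parents, no
  arc into the root, and reachability. \<open>is_root\<close> and \<open>nonempty_treeI\<close> show
  that this describes the same trees.\<close>

locale nonempty_tree = pair_digraph T for T :: "'a pair_pre_digraph" +
  fixes r :: 'a
  assumes root_in_verts: "r \<in> pverts T"
    and no_arc_to_root: "(u, r) \<notin> parcs T"
    and single_valued_parent: "single_valued ((parcs T)\<inverse>)"
    and reachable_from_root: "v \<in> pverts T \<Longrightarrow> (r, v) \<in> (parcs T)\<^sup>*"
begin

lemma parent_unique: "(u, v) \<in> parcs T \<Longrightarrow> (w, v) \<in> parcs T \<Longrightarrow> u = w"
  using single_valued_parent by (auto dest: single_valuedD)

lemma trancl_verts: "(u, v) \<in> (parcs T)\<^sup>+ \<Longrightarrow> u \<in> pverts T \<and> v \<in> pverts T"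
  by (induction rule: trancl_induct) (auto intro: in_arcsD1 in_arcsD2)

lemma no_trancl_to_root: "(u, r) \<notin> (parcs T)\<^sup>+"
  by (auto dest: tranclD2 simp: no_arc_to_root)

lemma trancl_parent: "(u, v) \<in> (parcs T)\<^sup>+ \<Longrightarrow> (w, v) \<in> parcs T \<Longrightarrow> (u, w) \<in> (parcs T)\<^sup>*"
  by (metis parent_unique tranclD2)

text \<open>Since parents are unique, a cycle through a child also passes through its parent. Going
  up the path from \<open>r\<close>, a cycle would reach the root, which no arc enters.\<close>

lemma trancl_irrefl: "(v, v) \<notin> (parcs T)\<^sup>+"
proof
  assume v: "(v, v) \<in> (parcs T)\<^sup>+"
  then have "(r, v) \<in> (parcs T)\<^sup>*" using reachable_from_root trancl_verts by blast
  then have "(v, v) \<notin> (parcs T)\<^sup>+"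
  proof (induction rule: rtrancl_induct)
    case base
    show ?case by (rule no_trancl_to_root)
  next
    case (step u w)
    then show ?case by (meson rtrancl_into_trancl2 trancl_parent)
  qed
  with v show False by blast
qed

text \<open>All ancestors of \<open>v\<close> lie on the single chain of parents above it: a
  single-valued relation is confluent in this strong sense.\<close>

lemma ancestors_comparable:
  assumes "(u, v) \<in> (parcs T)\<^sup>+" "(w, v) \<in> (parcs T)\<^sup>+"
  shows "u = w \<or> (u, w) \<in> (parcs T)\<^sup>+ \<or> (w, u) \<in> (parcs T)\<^sup>+"
proof -
  have "(v, u) \<in> ((parcs T)\<inverse>)\<^sup>*" "(v, w) \<in> ((parcs T)\<inverse>)\<^sup>*"
    using assms by (auto simp: rtrancl_converse)
  from single_valued_confluent[OF single_valued_parent this]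
  show ?thesis by (auto simp: rtrancl_converse rtrancl_eq_or_trancl)
qed

lemma root_trancl_iff: "(r, v) \<in> (parcs T)\<^sup>+ \<longleftrightarrow> v \<in> pverts T - {r}"
  using reachable_from_root[of v] trancl_verts[of r v] trancl_irrefl[of r]
  by (auto simp: rtrancl_eq_or_trancl)

text \<open>The two walks are compared from their ends: the last arc is forced by the unique parent,
  and only the empty walk leads from the root back to it.\<close>

lemma walk_unique:
  "pcas r p v \<Longrightarrow> set p \<subseteq> parcs T \<Longrightarrow> pcas r q v \<Longrightarrow> set q \<subseteq> parcs T \<Longrightarrow> p = q"
proof (induction p arbitrary: v q rule: rev_induct)
  case Nil
  then show ?case
    by (cases q rule: rev_cases) (auto simp: pcas_append no_arc_to_root simp del: cas_append_iff)
next
  case (snoc e p)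
  obtain c where e: "e = (c, v)" "(c, v) \<in> parcs T" "pcas r p c" "set p \<subseteq> parcs T"
    using snoc.prems by (cases e) (auto simp: pcas_append simp del: cas_append_iff)
  then have "q \<noteq> []" using snoc.prems no_arc_to_root by auto
  then obtain q' e' where q: "q = q' @ [e']" by (metis rev_exhaust)
  obtain c' where e': "e' = (c', v)" "(c', v) \<in> parcs T" "pcas r q' c'" "set q' \<subseteq> parcs T"
    using snoc.prems q by (cases e') (auto simp: pcas_append simp del: cas_append_iff)
  have "c = c'" using e e' by (auto intro: parent_unique)
  with snoc.IH[of c q'] e e' q show ?case by auto
qed

lemma is_root: "is_root T r"
  unfolding is_root_def awalk_with_proj_iff
proof (intro conjI ballI impI root_in_verts)
  fix v assume "v \<in> pverts T"
  with rtrancl_imp_pcas[OF reachable_from_root] obtain p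
    where "set p \<subseteq> parcs T" "pcas r p v" by blast
  then show "\<exists>!p. r \<in> pverts T \<and> set p \<subseteq> parcs T \<and> pcas r p v"
    using root_in_verts walk_unique by (intro ex1I[of _ p]) blast+
qed

lemma rooted_tree: "rooted_tree T"
  unfolding rooted_tree_def using is_root pair_digraph_axioms by blast

end

text \<open>An arc from \<open>u\<close> into the root could be prolonged to a second walk to
  \<open>u\<close>; as loops are excluded, \<open>u\<close> is not the root, so uniqueness applies
  to it. Two parents of one node would give two walks to it that differ in the last arc.\<close>

lemma nonempty_treeI:
  assumes "pair_digraph T" "is_root T r"
  shows "nonempty_tree T r"
proof -
  interpret pair_digraph T by fact
  have rV: "r \<in> pverts T" using assms(2) by (simp add: is_root_def)
  have uniq: "p = q"
    if "v \<in> pverts T" "v \<noteq> r" "set p \<subseteq> parcs T" "pcas r p v" "set q \<subseteq> parcs T" "pcas r q v" for p q v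
    using assms(2) that unfolding is_root_def awalk_with_proj_iff by blast
  have reach: "\<exists>p. set p \<subseteq> parcs T \<and> pcas r p v" if "v \<in> pverts T" for v
  proof (cases "v = r")
    case True
    then show ?thesis by (intro exI[of _ "[]"]) simp
  next
    case False
    with assms(2) that show ?thesis unfolding is_root_def awalk_with_proj_iff by blast
  qed
  have no_arc: "(u, r) \<notin> parcs T" for u
  proof
    assume u: "(u, r) \<in> parcs T"
    then have "u \<in> pverts T" "u \<noteq> r" using in_arcsD1 no_loops' by auto
    obtain p where p: "set p \<subseteq> parcs T" "pcas r p u" using reach[OF \<open>u \<in> pverts T\<close>] by blast
    have "set (p @ (u, r) # p) \<subseteq> parcs T" "pcas r (p @ (u, r) # p) u"
      using p u by (auto simp: pcas_append simp del: cas_append_iff)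
    with p have "p = p @ (u, r) # p" by (rule uniq[OF \<open>u \<in> pverts T\<close> \<open>u \<noteq> r\<close>])
    then show False by simp
  qed
  have parent: "u = w" if arcs: "(u, v) \<in> parcs T" "(w, v) \<in> parcs T" for u v w
  proof -
    obtain p q where p: "set p \<subseteq> parcs T" "pcas r p u" and q: "set q \<subseteq> parcs T" "pcas r q w"
      using reach[OF in_arcsD1[OF arcs(1)]] reach[OF in_arcsD1[OF arcs(2)]] by blast
    then have "p @ [(u, v)] = q @ [(w, v)]"
      using arcs no_arc by (intro uniq[of v]) (auto simp: pcas_append simp del: cas_append_iff intro: in_arcsD2)
    then show ?thesis by simp
  qed
  show ?thesis
  proof unfold_locales
    show "single_valued ((parcs T)\<inverse>)" using parent by (auto intro: single_valuedI)
    show "(r, v) \<in> (parcs T)\<^sup>*" if "v \<in> pverts T" for v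
      using reach[OF that] pcas_imp_rtrancl by metis
  qed (use rV no_arc in auto)
qed

lemma rooted_tree_nonempty:
  assumes "rooted_tree T" "pverts T \<noteq> {}"
  obtains r where "nonempty_tree T r"
  using assms unfolding rooted_tree_def by (auto intro: nonempty_treeI)

text \<open>Any other root would reach \<open>r\<close>, but no arc enters \<open>r\<close>.\<close>

lemma (in nonempty_tree) tree_root_eq: "tree_root T = r"
  unfolding tree_root_def
proof (rule the_equality)
  show "is_root T r" by (rule is_root)
  fix s assume "is_root T s"
  then interpret s: nonempty_tree T s by (intro nonempty_treeI pair_digraph_axioms)
  show "s = r"
    using s.reachable_from_root[OF root_in_verts] no_trancl_to_root
    by (auto simp: rtrancl_eq_or_trancl)
qed

section \<open>Minor embeddings as embeddings of the strict ancestor order\<close>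

lemma (in nonempty_tree) between_in_inner_verts:
  assumes "pcas u p v" "set p \<subseteq> parcs T" "(u, w) \<in> (parcs T)\<^sup>+" "(w, v) \<in> (parcs T)\<^sup>+"
  shows "w \<in> set (pre_digraph.inner_verts (with_proj T) p)"
  using assms
proof (induction p arbitrary: v rule: rev_induct)
  case Nil
  then have "(u, u) \<in> (parcs T)\<^sup>+" by (auto intro: trancl_trans)
  with trancl_irrefl show ?case by blast
next
  case (snoc e p)
  \<comment> \<open>Split off the last arc. As \<open>c\<close> is the only parent of
    \<open>v\<close>, the ancestor \<open>w\<close> of \<open>v\<close> is \<open>c\<close> itself
    or an ancestor of \<open>c\<close>.\<close>
  obtain c where e: "e = (c, v)" and c: "(c, v) \<in> parcs T" "pcas u p c"
    using snoc.prems by (cases e) (auto simp: pcas_append simp del: cas_append_iff)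
  then have p: "p \<noteq> []"
    using snoc.prems trancl_parent[of w v u] trancl_irrefl[of u] by (auto dest: trancl_rtrancl_trancl)
  show ?case
  proof (cases "w = c")
    case True
    then show ?thesis using p e by (cases p) (auto simp: pre_digraph.inner_verts_def)
  next
    case False
    then have "(w, c) \<in> (parcs T)\<^sup>+"
      using trancl_parent[OF snoc.prems(4) c(1)] by (simp add: rtrancl_eq_or_trancl)
    with snoc c have "w \<in> set (pre_digraph.inner_verts (with_proj T) p)" by auto
    with p show ?thesis by (cases p) (auto simp: pre_digraph.inner_verts_def)
  qed
qed

text \<open>Arcs go to nontrivial paths, which gives the direction from \<open>S\<close> to
  \<open>T\<close>. For the converse, descend from the root of \<open>S\<close> to \<open>v\<close>:
  the image of \<open>u\<close> is comparable with that of the parent of \<open>v\<close> and cannot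
  lie strictly between the images of that parent and \<open>v\<close>.\<close>

lemma minor_embedding_trancl_iff:
  assumes "nonempty_tree S s" "nonempty_tree T t" "minor_embedding f S T"
    and "u \<in> pverts S" "v \<in> pverts S"
  shows "(f u, f v) \<in> (parcs T)\<^sup>+ \<longleftrightarrow> (u, v) \<in> (parcs S)\<^sup>+"
proof -
  interpret S: nonempty_tree S s by fact
  interpret T: nonempty_tree T t by fact
  have inj: "inj_on f (pverts S)"
    and walk: "\<exists>p. pcas (f u) p (f v) \<and> set p \<subseteq> parcs T \<and>
      set (pre_digraph.inner_verts (with_proj T) p) \<inter> f ` pverts S = {}"
    if "(u, v) \<in> parcs S" for u v
    using assms(3) that unfolding minor_embedding_def awalk_with_proj_iff by blast+
  have arc: "(f u, f v) \<in> (parcs T)\<^sup>+" if uv: "(u, v) \<in> parcs S" for u v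
  proof -
    have "u \<in> pverts S" "v \<in> pverts S" "u \<noteq> v"
      using uv S.in_arcsD1 S.in_arcsD2 S.no_loops' by auto
    then have "f u \<noteq> f v" using inj[OF uv] by (auto dest: inj_onD)
    moreover have "(f u, f v) \<in> (parcs T)\<^sup>*" using walk[OF uv] pcas_imp_rtrancl by metis
    ultimately show ?thesis by (simp add: rtrancl_eq_or_trancl)
  qed
  have fwd: "(f u, f v) \<in> (parcs T)\<^sup>+" if "(u, v) \<in> (parcs S)\<^sup>+" for u v
    using that by (induction rule: trancl_induct) (auto intro: arc trancl_trans)
  have bwd: "(u, v) \<in> (parcs S)\<^sup>+"
    if "(s, v) \<in> (parcs S)\<^sup>*" "u \<in> pverts S" "(f u, f v) \<in> (parcs T)\<^sup>+" for u v
    using that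
  proof (induction rule: rtrancl_induct)
    case base
    \<comment> \<open>The root of \<open>S\<close> is above every other node, so an image above
      \<open>f s\<close> would close a cycle in \<open>T\<close>.\<close>
    then have "u \<noteq> s" using T.trancl_irrefl by auto
    then have "(f s, f u) \<in> (parcs T)\<^sup>+" using base by (intro fwd) (simp add: S.root_trancl_iff)
    with base(2) show ?case using T.trancl_irrefl trancl_trans by metis
  next
    case (step w v)
    have w: "w \<in> pverts S" using step.hyps S.in_arcsD1 by auto
    \<comment> \<open>Otherwise \<open>f u\<close> would be an inner node of the walk chosen for the
      arc \<open>(w, v)\<close>, which avoids the image of \<open>f\<close>.\<close>
    have "(f w, f u) \<notin> (parcs T)\<^sup>+"
      using walk[OF step.hyps(2)] step.prems T.between_in_inner_verts by blast
    then consider "f u = f w" | "(f u, f w) \<in> (parcs T)\<^sup>+"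
      using T.ancestors_comparable[OF step.prems(2) arc[OF step.hyps(2)]] by blast
    then show ?case
    proof cases
      case 1
      then have "u = w" using inj[OF step.hyps(2)] step.prems w by (auto dest: inj_onD)
      with step.hyps show ?thesis by auto
    next
      case 2
      with step show ?thesis by (meson trancl.trancl_into_trancl)
    qed
  qed
  show ?thesis
    using fwd bwd assms S.reachable_from_root by blast
qed

section \<open>Two nested forks in a small forest\<close>

text \<open>
  \<open>R\<close> is the strict ancestor relation of a tree on the nodes \<open>W\<close> with root \<open>a\<close>: below \<open>a\<close> are the node
  \<open>b\<close>, which carries \<open>X\<close> and \<open>Y\<close>, and the tree \<open>Z\<close>. Both trees of the theorem have this shape, with
  $(b, X, Y, Z) = (y, P, R, S)$ and $(z, R, S, P)$. \<open>R\<close> may also relate nodes outside \<open>W\<close>, so that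
  the copy can sit inside a larger tree.
\<close>

locale nested_fork =
  fixes R :: "'a rel" and W :: "'a set" and a b :: 'a and X Y Z :: "'a set"
  assumes cover: "W = {a, b} \<union> (X \<union> Y \<union> Z)"
    and a_neq_b: "a \<noteq> b"
    and a_notin: "a \<notin> X \<union> Y \<union> Z"
    and b_notin: "b \<notin> X \<union> Y \<union> Z"
    and disjoint: "X \<inter> Y = {}" "X \<inter> Z = {}" "Y \<inter> Z = {}"
    and below_a: "R `` {a} \<inter> W = W - {a}"
    and below_b: "R `` {b} \<inter> W = X \<union> Y"
    and below_X: "x \<in> X \<Longrightarrow> R `` {x} \<inter> W \<subseteq> X"
    and below_Y: "x \<in> Y \<Longrightarrow> R `` {x} \<inter> W \<subseteq> Y"
    and below_Z: "x \<in> Z \<Longrightarrow> R `` {x} \<inter> W \<subseteq> Z"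
    and top_Z: "\<exists>t\<in>Z. R `` {t} \<inter> W = Z - {t}"
begin

lemmas fork_facts = cover a_neq_b a_notin b_notin disjoint below_a below_b below_X below_Y below_Z top_Z

end

text \<open>The shape is expressed through \<open>R\<close> restricted to \<open>W\<close> alone, so
  any order embedding transports it into a larger tree.\<close>

lemma nested_fork_image:
  assumes "nested_fork R W a b X Y Z" "inj_on f W"
    and iff: "\<And>u v. u \<in> W \<Longrightarrow> v \<in> W \<Longrightarrow> (f u, f v) \<in> R' \<longleftrightarrow> (u, v) \<in> R"
  shows "nested_fork R' (f ` W) (f a) (f b) (f ` X) (f ` Y) (f ` Z)"
proof -
  have D: "R' `` {f u} \<inter> f ` W = f ` (R `` {u} \<inter> W)" if "u \<in> W" for u
    using that by (auto simp: iff)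
  have sub: "a \<in> W" "b \<in> W" "X \<subseteq> W" "Y \<subseteq> W" "Z \<subseteq> W"
    using nested_fork.cover[OF assms(1)] by blast+
  have eq: "f u = f v \<longleftrightarrow> u = v" if "u \<in> W" "v \<in> W" for u v
    using that assms(2) by (auto dest: inj_onD)
  have disj: "f ` A \<inter> f ` B = f ` (A \<inter> B)" if "A \<subseteq> W" "B \<subseteq> W" for A B
    using that inj_on_image_Int[OF assms(2)] by blast
  have diff: "f ` (A - {u}) = f ` A - {f u}" if "A \<subseteq> W" "u \<in> W" for A u
    using that inj_on_image_set_diff[OF assms(2), of A "{u}"] by auto
  have mem: "f u \<in> f ` A \<longleftrightarrow> u \<in> A" if "A \<subseteq> W" "u \<in> W" for A u
    using that assms(2) by (auto dest: inj_onD)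
  note fork = nested_fork.fork_facts[OF assms(1)]
  have W: "f ` W = {f a, f b} \<union> (f ` X \<union> f ` Y \<union> f ` Z)"
    using fork(1) by (simp add: image_Un)
  have XYZ: "X \<union> Y \<union> Z \<subseteq> W" using sub by blast
  obtain t where t: "t \<in> Z" "R `` {t} \<inter> W = Z - {t}" using fork(13) by blast
  show ?thesis
  proof
    show "f ` W = {f a, f b} \<union> (f ` X \<union> f ` Y \<union> f ` Z)" by (fact W)
    show "f a \<noteq> f b" using fork(2) sub by (simp add: eq)
    show "f a \<notin> f ` X \<union> f ` Y \<union> f ` Z" "f b \<notin> f ` X \<union> f ` Y \<union> f ` Z"
      using fork(3,4) sub mem[OF XYZ] by (simp_all add: image_Un)
    show "f ` X \<inter> f ` Y = {}" "f ` X \<inter> f ` Z = {}" "f ` Y \<inter> f ` Z = {}"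
      using fork(5-7) sub by (simp_all add: disj)
    show "R' `` {f a} \<inter> f ` W = f ` W - {f a}" using fork(8) sub by (simp add: D diff)
    show "R' `` {f b} \<inter> f ` W = f ` X \<union> f ` Y" using fork(9) sub by (simp add: D image_Un)
    have below: "R' `` {x} \<inter> f ` W \<subseteq> f ` A"
      if x: "x \<in> f ` A" and A: "A \<subseteq> W" "\<And>x. x \<in> A \<Longrightarrow> R `` {x} \<inter> W \<subseteq> A" for x A
    proof -
      obtain u where u: "u \<in> A" "x = f u" using x by blast
      then show ?thesis using A(1) A(2)[OF u(1)] D[of u] by blast
    qed
    show "x \<in> f ` X \<Longrightarrow> R' `` {x} \<inter> f ` W \<subseteq> f ` X" "x \<in> f ` Y \<Longrightarrow> R' `` {x} \<inter> f ` W \<subseteq> f ` Y"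
      "x \<in> f ` Z \<Longrightarrow> R' `` {x} \<inter> f ` W \<subseteq> f ` Z" for x
      using below[OF _ sub(3) fork(10)] below[OF _ sub(4) fork(11)] below[OF _ sub(5) fork(12)]
      by blast+
    show "\<exists>t\<in>f ` Z. R' `` {t} \<inter> f ` W = f ` Z - {t}"
    proof (rule bexI)
      show "R' `` {f t} \<inter> f ` W = f ` Z - {f t}" using t sub by (auto simp: D diff subset_iff)
    qed (use t in blast)
  qed
qed

section \<open>Counting descendants in a finite forest order\<close>

locale forest_order =
  fixes R :: "'a rel" and V :: "'a set"
  assumes finite: "finite V"
    and trans: "trans R"
    and irrefl: "(v, v) \<notin> R"
    and comparable: "(u, v) \<in> R \<Longrightarrow> (w, v) \<in> R \<Longrightarrow> u = w \<or> (u, w) \<in> R \<or> (w, u) \<in> R"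
begin

lemma Image_mono: "(x, y) \<in> R \<Longrightarrow> R `` {y} \<subseteq> R `` {x}"
  using transD[OF trans] by blast

text \<open>These counts serve to tell the positions in a copy apart. The bounds for the components
  are strict because no node is its own descendant.\<close>

lemma nested_fork_card:
  assumes "nested_fork R W a b X Y Z" "W \<subseteq> V"
  shows "card W = card X + card Y + card Z + 2"
    and "card (R `` {a} \<inter> W) = card X + card Y + card Z + 1"
    and "card (R `` {b} \<inter> W) = card X + card Y"
    and "x \<in> X \<Longrightarrow> card (R `` {x} \<inter> W) < card X"
    and "x \<in> Y \<Longrightarrow> card (R `` {x} \<inter> W) < card Y"
    and "x \<in> Z \<Longrightarrow> card (R `` {x} \<inter> W) < card Z"
proof -
  note fork = nested_fork.fork_facts[OF assms(1)]
  have fin: "finite W" using assms(2) finite finite_subset by blast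
  then have fin': "finite X" "finite Y" "finite Z" using fork(1) by auto
  have XYZ: "card (X \<union> Y \<union> Z) = card X + card Y + card Z"
  proof -
    have "card (X \<union> Y \<union> Z) = card (X \<union> Y) + card Z"
      using fork(6,7) fin' by (intro card_Un_disjoint) auto
    then show ?thesis using fork(5) fin' by (simp add: card_Un_disjoint)
  qed
  have "card W = card {a, b} + card (X \<union> Y \<union> Z)"
    unfolding fork(1) using fork(3,4) fin' by (intro card_Un_disjoint) auto
  then show W: "card W = card X + card Y + card Z + 2" using fork(2) XYZ by simp
  have "a \<in> W" using fork(1) by blast
  then show "card (R `` {a} \<inter> W) = card X + card Y + card Z + 1"
    unfolding fork(8) using fin W by simp
  show "card (R `` {b} \<inter> W) = card X + card Y"
    unfolding fork(9) using fork(5) fin' by (simp add: card_Un_disjoint)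
  have less: "card (R `` {x} \<inter> W) < card A"
    if "finite A" "x \<in> A" "R `` {x} \<inter> W \<subseteq> A" for A
    using that irrefl by (intro psubset_card_mono) auto
  show "x \<in> X \<Longrightarrow> card (R `` {x} \<inter> W) < card X"
    "x \<in> Y \<Longrightarrow> card (R `` {x} \<inter> W) < card Y"
    "x \<in> Z \<Longrightarrow> card (R `` {x} \<inter> W) < card Z"
    using less[OF fin'(1) _ fork(10)] less[OF fin'(2) _ fork(11)] less[OF fin'(3) _ fork(12)]
    by blast+
qed

theorem no_small_common_superorder:
  assumes fork1: "nested_fork R W1 a y P1 R1 S1" and fork2: "nested_fork R W2 a' z R2 S2 P2"
    and sub: "W1 \<subseteq> V" "W2 \<subseteq> V"
    and cards: "card P1 = p" "card P2 = p" "card R1 = r" "card R2 = r" "card S1 = s" "card S2 = s"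
    and sizes: "0 < p" "p + 2 \<le> s" "s < p + r"
  shows "p + r + s + 3 < card V"
proof (rule ccontr)
  assume "\<not> p + r + s + 3 < card V"
  then have V: "card V \<le> p + r + s + 3" by simp
  note f1 = nested_fork.fork_facts[OF fork1] and f2 = nested_fork.fork_facts[OF fork2]
  note c1 = nested_fork_card[OF fork1 sub(1), unfolded cards]
    and c2 = nested_fork_card[OF fork2 sub(2), unfolded cards]
  \<comment> \<open>\<open>D x\<close> refers to neither copy. A node lying in both copies has its
    descendants counted in each of them, and both counts must fall short of \<open>D x\<close> by at
    most one.\<close>
  define D where "D x = card (R `` {x} \<inter> V)" for x
  have D: "card (R `` {x} \<inter> W) \<le> D x" "D x \<le> card (R `` {x} \<inter> W) + 1"
    if "W \<subseteq> V" "card W = p + r + s + 2" for W x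
  proof -
    have fin: "finite W" using that finite finite_subset by blast
    show "card (R `` {x} \<inter> W) \<le> D x" unfolding D_def
      using finite that by (intro card_mono) auto
    have "D x \<le> card ((R `` {x} \<inter> W) \<union> (V - W))" unfolding D_def
      using finite fin by (intro card_mono) auto
    also have "\<dots> \<le> card (R `` {x} \<inter> W) + card (V - W)" by (rule card_Un_le)
    also have "card (V - W) \<le> 1" using that fin V by (simp add: card_Diff_subset)
    finally show "D x \<le> card (R `` {x} \<inter> W) + 1" by simp
  qed
  have W: "card W1 = p + r + s + 2" "card W2 = p + r + s + 2" using c1(1) c2(1) by auto
  note D1 = D[OF sub(1) W(1)] and D2 = D[OF sub(2) W(2)]
  have outside: "V - W = {v}" if "v \<in> V" "v \<notin> W" "W \<subseteq> V" "card W = p + r + s + 2" for v W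
  proof -
    have "finite W" using that finite finite_subset by blast
    then have "card (V - W) \<le> 1" using that V by (simp add: card_Diff_subset)
    moreover have "card (V - W) \<noteq> 0" using that finite by auto
    ultimately have "card (V - W) = 1" by simp
    then obtain x where "V - W = {x}" by (rule card_1_singletonE)
    moreover have "v \<in> V - W" using that by blast
    ultimately show ?thesis by simp
  qed
  have zV: "z \<in> V" "z \<in> W2" and yV: "y \<in> V" "y \<in> W1" and aV: "a \<in> W1" "a' \<in> W2"
    using f1(1) f2(1) sub by auto
  \<comment> \<open>In the copy of $T_2$ the node \<open>z\<close> has \<open>r + s\<close>
    descendants. Being \<open>a\<close> is excluded by \<open>0 < p\<close>, being \<open>y\<close>
    by \<open>p + 2 \<le> s\<close>, where 2 exceeds the tolerance of one; nodes of components have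
    too few descendants.\<close>
  have "z \<notin> W1"
  proof
    assume "z \<in> W1"
    then consider "z = a" | "z = y" | "z \<in> P1" | "z \<in> R1" | "z \<in> S1" using f1(1) by blast
    then show False
      using c1(2,3) c1(4-6)[of z] c2(3) D1[of z] D2[of z] sizes by cases auto
  qed
  then have z: "V - W1 = {z}" using outside[OF zV(1) \<open>z \<notin> W1\<close> sub(1) W(1)] by blast
  \<comment> \<open>Here \<open>y\<close> has \<open>p + r\<close> descendants in its own copy. The
    critical case is \<open>y\<close> inside \<open>S2\<close>, which \<open>s < p + r\<close>
    excludes.\<close>
  have "y \<notin> W2"
  proof
    assume "y \<in> W2"
    then consider "y = a'" | "y = z" | "y \<in> R2" | "y \<in> S2" | "y \<in> P2" using f2(1) by blast
    then show False
      using c2(2,3) c2(4-6)[of y] c1(3) D1[of y] D2[of y] sizes \<open>z \<notin> W1\<close> yV by cases auto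
  qed
  then have y: "V - W2 = {y}" using outside[OF yV(1) \<open>y \<notin> W2\<close> sub(2) W(2)] by blast
  have "a \<in> W2" using y aV sub f1(2) by blast
  then consider "a = a'" | "a = z" | "a \<in> R2" | "a \<in> S2" | "a \<in> P2" using f2(1) by blast
  then have a: "a = a'"
    using c2(3) c2(4-6)[of a] c1(2) D1[of a] D2[of a] sizes by cases auto
  \<comment> \<open>\<open>V\<close> is \<open>W1\<close> with \<open>z\<close> added and also
    \<open>W2\<close> with \<open>y\<close> added, so removing the root and both forks leaves
    exactly the three components of either copy.\<close>
  define M where "M = V - {a, y, z}"
  have M1: "M = P1 \<union> R1 \<union> S1" "M \<subseteq> W1" and M2: "M = R2 \<union> S2 \<union> P2" "M \<subseteq> W2"
    using f1(1,3,4) f2(1,3,4) y z sub unfolding M_def a by blast+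
  have fin: "finite M" using finite unfolding M_def by blast
  have cM: "card M = p + r + s"
  proof -
    have "M = W1 - {a, y}" using M1 f1(1,3,4) by blast
    then show ?thesis using W(1) f1(2) aV yV by (simp add: card_Diff_subset)
  qed
  have Ry: "R `` {y} \<inter> M = P1 \<union> R1" using f1(9) M1 by blast
  have Rz: "R `` {z} \<inter> M = R2 \<union> S2" using f2(9) M2 by blast
  have Ry': "card (R `` {y} \<inter> M) = p + r" using c1(3) unfolding f1(9) Ry .
  have Rz': "card (R `` {z} \<inter> M) = r + s" using c2(3) unfolding f2(9) Rz .
  \<comment> \<open>Disjointness would force \<open>(p + r) + (r + s) \<le> p + r + s\<close>, but
    the inequalities make \<open>r\<close> positive.\<close>
  have "(R `` {y} \<inter> M) \<inter> (R `` {z} \<inter> M) \<noteq> {}"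
  proof
    assume "(R `` {y} \<inter> M) \<inter> (R `` {z} \<inter> M) = {}"
    then have "card (R `` {y} \<inter> M) + card (R `` {z} \<inter> M) = card ((R `` {y} \<inter> M) \<union> (R `` {z} \<inter> M))"
      using fin by (simp add: card_Un_disjoint)
    also have "\<dots> \<le> card M" using fin by (intro card_mono) auto
    finally show False using Ry' Rz' cM sizes by simp
  qed
  then obtain v where "(y, v) \<in> R" "(z, v) \<in> R" by blast
  moreover have "y \<noteq> z" using yV \<open>z \<notin> W1\<close> by blast
  moreover have "(y, z) \<notin> R"
  proof
    assume "(y, z) \<in> R"
    then have "card (R `` {z} \<inter> M) \<le> card (R `` {y} \<inter> M)"
      using fin Image_mono by (intro card_mono) blast+
    then show False using Ry' Rz' sizes by simp
  qed
  ultimately have "(z, y) \<in> R" using comparable by blast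
  then have "R `` {y} \<inter> M \<subseteq> R `` {z} \<inter> M" using Image_mono by blast
  \<comment> \<open>Within \<open>M\<close>, the nodes not below \<open>y\<close> form
    \<open>S1\<close> and those not below \<open>z\<close> form \<open>P2\<close>, so the inclusion
    is reversed.\<close>
  then have PS: "P2 \<subseteq> S1" using Ry Rz M1(1) M2(1) f2(6,7) by blast
  \<comment> \<open>Compare the roots of the components \<open>S1\<close> and \<open>P2\<close>. If
    they coincide, they have the same descendants in \<open>M\<close> and the components are equal,
    against their sizes; otherwise a cycle between the two roots arises.\<close>
  obtain t1 where t1: "t1 \<in> S1" "R `` {t1} \<inter> W1 = S1 - {t1}" using f1(13) by blast
  obtain t2 where t2: "t2 \<in> P2" "R `` {t2} \<inter> W2 = P2 - {t2}" using f2(13) by blast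
  have "t1 \<noteq> t2"
  proof
    assume t: "t1 = t2"
    have "R `` {t1} \<inter> M = S1 - {t1}" using t1 M1 by blast
    moreover have "R `` {t2} \<inter> M = P2 - {t2}" using t2 M2 by blast
    ultimately have "S1 = P2" using t t1 t2 by blast
    then show False using cards sizes by simp
  qed
  then have t12: "(t1, t2) \<in> R" using t1 t2 PS by blast
  have "t2 \<in> W2" "t1 \<in> M" using t1 t2 M1 M2 by blast+
  \<comment> \<open>The components \<open>R2\<close> and \<open>S2\<close> are closed under
    descendants in \<open>W2\<close>, so a node above \<open>t2\<close> can lie in neither.\<close>
  with t12 have "t1 \<in> P2" using f2(6,7) f2(10,11)[of t1] M2(1) t2(1) by blast
  then have "(t2, t1) \<in> R" using t2 \<open>t1 \<noteq> t2\<close> by blast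
  with t12 have "(t1, t1) \<in> R" by (rule transD[OF trans])
  with irrefl show False by blast
qed

end

section \<open>Joins\<close>

text \<open>The two codings inside \<open>join\<close>, named so that they behave like free
  constructors via \<open>node_simps\<close> and no arithmetic is left in the proofs.\<close>

definition lnode :: "nat \<Rightarrow> nat" where "lnode v = 2 * v + 1"

definition rnode :: "nat \<Rightarrow> nat" where "rnode v = 2 * v + 2"

lemma node_simps [simp]:
  "lnode u = lnode v \<longleftrightarrow> u = v" "rnode u = rnode v \<longleftrightarrow> u = v"
  "lnode u \<noteq> rnode v" "rnode u \<noteq> lnode v"
  "lnode v \<noteq> 0" "rnode v \<noteq> 0" "0 \<noteq> lnode v" "0 \<noteq> rnode v"
  unfolding lnode_def rnode_def by presburger+

lemma inj_nodes [simp]: "inj_on lnode U" "inj_on rnode U"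
  by (auto intro: inj_onI)

lemma pverts_join [simp]: "pverts (join A B) = {0} \<union> lnode ` pverts A \<union> rnode ` pverts B"
  unfolding join_def lnode_def rnode_def by simp

lemma parcs_join:
  "parcs (join A B) = {(0, lnode (tree_root A)), (0, rnode (tree_root B))}
     \<union> map_prod lnode lnode ` parcs A \<union> map_prod rnode rnode ` parcs B"
  unfolding join_def lnode_def rnode_def map_prod_def by (simp add: image_def)

lemma mem_map_prod_image_iff:
  "(x, y) \<in> map_prod f g ` E \<longleftrightarrow> (\<exists>u v. x = f u \<and> y = g v \<and> (u, v) \<in> E)"
  by force

context
  fixes A B :: ntree and ra rb :: nat
  assumes A: "nonempty_tree A ra" and B: "nonempty_tree B rb"
begin

interpretation A: nonempty_tree A ra by (fact A)
interpretation B: nonempty_tree B rb by (fact B)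

lemma join_arc_iff:
  "(0, w) \<in> parcs (join A B) \<longleftrightarrow> w = lnode ra \<or> w = rnode rb"
  "(lnode u, w) \<in> parcs (join A B) \<longleftrightarrow> (\<exists>v. w = lnode v \<and> (u, v) \<in> parcs A)"
  "(rnode u, w) \<in> parcs (join A B) \<longleftrightarrow> (\<exists>v. w = rnode v \<and> (u, v) \<in> parcs B)"
  by (auto simp: parcs_join A.tree_root_eq B.tree_root_eq mem_map_prod_image_iff)

text \<open>No arc leaves the copy of \<open>A\<close>, so below its nodes the join looks exactly
  like \<open>A\<close>.\<close>

lemma trancl_join_lnode:
  "(parcs (join A B))\<^sup>+ `` {lnode u} = lnode ` ((parcs A)\<^sup>+ `` {u})"
proof -
  have down: "\<exists>v. w = lnode v \<and> (u, v) \<in> (parcs A)\<^sup>+" if "(lnode u, w) \<in> (parcs (join A B))\<^sup>+" for w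
    using that
  proof (induction rule: trancl_induct)
    case (base w)
    then show ?case unfolding join_arc_iff by blast
  next
    case (step w x)
    then obtain v where v: "w = lnode v" "(u, v) \<in> (parcs A)\<^sup>+" by blast
    with step.hyps(2) obtain v' where "x = lnode v'" "(v, v') \<in> parcs A"
      unfolding v(1) join_arc_iff by blast
    with v(2) show ?case by (blast intro: trancl.trancl_into_trancl)
  qed
  have up: "(lnode u, lnode v) \<in> (parcs (join A B))\<^sup>+" if "(u, v) \<in> (parcs A)\<^sup>+" for v
    using that
  proof (induction rule: trancl_induct)
    case (base v)
    then have "(lnode u, lnode v) \<in> parcs (join A B)" unfolding join_arc_iff by blast
    then show ?case by (rule r_into_trancl)
  next
    case (step v w)
    from step.hyps(2) have "(lnode v, lnode w) \<in> parcs (join A B)" unfolding join_arc_iff by blast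
    with step.IH show ?case by (rule trancl.trancl_into_trancl)
  qed
  show ?thesis
  proof (intro equalityI subsetI, goal_cases)
    case (1 w)
    with down[of w] show ?case by auto
  next
    case (2 w)
    with up show ?case by auto
  qed
qed

lemma trancl_join_rnode:
  "(parcs (join A B))\<^sup>+ `` {rnode u} = rnode ` ((parcs B)\<^sup>+ `` {u})"
proof -
  have down: "\<exists>v. w = rnode v \<and> (u, v) \<in> (parcs B)\<^sup>+" if "(rnode u, w) \<in> (parcs (join A B))\<^sup>+" for w
    using that
  proof (induction rule: trancl_induct)
    case (base w)
    then show ?case unfolding join_arc_iff by blast
  next
    case (step w x)
    then obtain v where v: "w = rnode v" "(u, v) \<in> (parcs B)\<^sup>+" by blast
    with step.hyps(2) obtain v' where "x = rnode v'" "(v, v') \<in> parcs B"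
      unfolding v(1) join_arc_iff by blast
    with v(2) show ?case by (blast intro: trancl.trancl_into_trancl)
  qed
  have up: "(rnode u, rnode v) \<in> (parcs (join A B))\<^sup>+" if "(u, v) \<in> (parcs B)\<^sup>+" for v
    using that
  proof (induction rule: trancl_induct)
    case (base v)
    then have "(rnode u, rnode v) \<in> parcs (join A B)" unfolding join_arc_iff by blast
    then show ?case by (rule r_into_trancl)
  next
    case (step v w)
    from step.hyps(2) have "(rnode v, rnode w) \<in> parcs (join A B)" unfolding join_arc_iff by blast
    with step.IH show ?case by (rule trancl.trancl_into_trancl)
  qed
  show ?thesis
  proof (intro equalityI subsetI, goal_cases)
    case (1 w)
    with down[of w] show ?case by auto
  next
    case (2 w)
    with up show ?case by auto
  qed
qed

lemma nonempty_tree_join: "nonempty_tree (join A B) 0"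
proof
  show "finite (pverts (join A B))"
    using A.pair_finite_verts B.pair_finite_verts by simp
  show "finite (parcs (join A B))"
    using A.pair_finite_arcs B.pair_finite_arcs by (simp add: parcs_join)
  show "0 \<in> pverts (join A B)" by simp
  show "(u, 0) \<notin> parcs (join A B)" for u by (auto simp: parcs_join)
  show "single_valued ((parcs (join A B))\<inverse>)"
    by (intro single_valuedI)
      (auto simp: parcs_join A.tree_root_eq B.tree_root_eq A.no_arc_to_root B.no_arc_to_root
        dest: A.parent_unique B.parent_unique)
  show "(0, v) \<in> (parcs (join A B))\<^sup>*" if "v \<in> pverts (join A B)" for v
  proof -
    have roots: "(0, lnode ra) \<in> parcs (join A B)" "(0, rnode rb) \<in> parcs (join A B)"
      by (simp_all add: join_arc_iff)
    from that consider "v = 0" | u where "v = lnode u" "u \<in> pverts A" | u where "v = rnode u" "u \<in> pverts B"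
      by auto
    then show ?thesis
    proof cases
      case 1
      then show ?thesis by simp
    next
      case (2 u)
      then have "(lnode ra, v) \<in> (parcs (join A B))\<^sup>*"
        using trancl_join_lnode[of ra] A.root_trancl_iff[of u]
        by (cases "u = ra") (auto intro: trancl_into_rtrancl)
      with roots show ?thesis by (blast intro: converse_rtrancl_into_rtrancl)
    next
      case (3 u)
      then have "(rnode rb, v) \<in> (parcs (join A B))\<^sup>*"
        using trancl_join_rnode[of rb] B.root_trancl_iff[of u]
        by (cases "u = rb") (auto intro: trancl_into_rtrancl)
      with roots show ?thesis by (blast intro: converse_rtrancl_into_rtrancl)
    qed
  qed
  fix e assume "e \<in> parcs (join A B)"
  then consider "e = (0, lnode ra)" | "e = (0, rnode rb)"
    | u v where "e = (lnode u, lnode v)" "(u, v) \<in> parcs A"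
    | u v where "e = (rnode u, rnode v)" "(u, v) \<in> parcs B"
    unfolding parcs_join A.tree_root_eq B.tree_root_eq by auto
  then have "fst e \<in> pverts (join A B) \<and> snd e \<in> pverts (join A B) \<and> fst e \<noteq> snd e"
  proof cases
    case (3 u v)
    then show ?thesis using A.in_arcsD1 A.in_arcsD2 A.no_loops'[of u v] by simp
  next
    case (4 u v)
    then show ?thesis using B.in_arcsD1 B.in_arcsD2 B.no_loops'[of u v] by simp
  qed (use A.root_in_verts B.root_in_verts in simp_all)
  then show "fst e \<in> pverts (join A B)" "snd e \<in> pverts (join A B)" "fst e \<noteq> snd e"
    by blast+
qed

lemma trancl_join_root: "(parcs (join A B))\<^sup>+ `` {0} = lnode ` pverts A \<union> rnode ` pverts B"
proof -
  have "(parcs (join A B))\<^sup>+ `` {0} = pverts (join A B) - {0}"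
    by (rule set_eqI) (simp only: Image_singleton_iff nonempty_tree.root_trancl_iff[OF nonempty_tree_join])
  also have "\<dots> = lnode ` pverts A \<union> rnode ` pverts B" by auto
  finally show ?thesis .
qed

lemma tree_size_join: "tree_size (join A B) = tree_size A + tree_size B + 1"
proof -
  have "card (lnode ` pverts A \<union> rnode ` pverts B) = card (pverts A) + card (pverts B)"
    using A.pair_finite_verts B.pair_finite_verts
    by (subst card_Un_disjoint) (auto simp: card_image)
  then show ?thesis
    using A.pair_finite_verts B.pair_finite_verts by (simp add: tree_size_def card_insert_if image_iff)
qed

end

text \<open>Paths with at most one intermediate node suffice for inclusions into a join and for the
  contraction of a single node.\<close>

lemma is_minorI:
  assumes "f ` pverts S \<subseteq> pverts T" "inj_on f (pverts S)"
    and "\<And>u v. (u, v) \<in> parcs S \<Longrightarrow> (f u, f v) \<in> parcs T \<or>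
      (\<exists>w. w \<notin> f ` pverts S \<and> (f u, w) \<in> parcs T \<and> (w, f v) \<in> parcs T)"
    and "pair_wf_digraph T"
  shows "is_minor S T"
proof -
  interpret T: pair_wf_digraph T by fact
  have "\<exists>p. pre_digraph.awalk (with_proj T) (f u) p (f v) \<and>
      set (pre_digraph.inner_verts (with_proj T) p) \<inter> f ` pverts S = {}"
    if uv: "(u, v) \<in> parcs S" for u v
    using assms(3)[OF uv]
  proof (elim disjE exE conjE)
    assume "(f u, f v) \<in> parcs T"
    then show ?thesis
      by (intro exI[of _ "[(f u, f v)]"])
        (auto simp: awalk_with_proj_iff pre_digraph.inner_verts_def intro: T.in_arcsD1)
  next
    fix w assume "w \<notin> f ` pverts S" "(f u, w) \<in> parcs T" "(w, f v) \<in> parcs T"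
    then show ?thesis
      by (intro exI[of _ "[(f u, w), (w, f v)]"])
        (auto simp: awalk_with_proj_iff pre_digraph.inner_verts_def intro: T.in_arcsD1)
  qed
  with assms(1,2) show ?thesis unfolding is_minor_def minor_embedding_def by blast
qed

lemma is_minor_join:
  assumes A: "nonempty_tree A ra" and B: "nonempty_tree B rb"
  shows "is_minor A (join A B)" "is_minor B (join A B)"
proof -
  interpret J: nonempty_tree "join A B" 0 by (rule nonempty_tree_join[OF A B])
  show "is_minor A (join A B)"
    by (rule is_minorI[of lnode]) (auto simp: join_arc_iff[OF A B] J.pair_wf_digraph)
  show "is_minor B (join A B)"
    by (rule is_minorI[of rnode]) (auto simp: join_arc_iff[OF A B] J.pair_wf_digraph)
qed

section \<open>The trees $T_1$ and $T_2$ as nested forks\<close>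

lemma (in nonempty_tree) forest_order: "forest_order ((parcs T)\<^sup>+) (pverts T)"
  using pair_finite_verts trancl_irrefl ancestors_comparable trans_trancl
  by unfold_locales

text \<open>\<open>lnode 0\<close> is the node $y$: the root of the inner join, coded as part of the
  left argument of the outer one.\<close>

lemma nested_fork_T1:
  assumes P: "nonempty_tree P p" and R: "nonempty_tree R r" and S: "nonempty_tree S s"
  shows "nested_fork ((parcs (tree_T1 P R S))\<^sup>+) (pverts (tree_T1 P R S)) 0 (lnode 0)
    (lnode ` lnode ` pverts P) (lnode ` rnode ` pverts R) (rnode ` pverts S)"
proof -
  interpret P: nonempty_tree P p by fact
  interpret R: nonempty_tree R r by fact
  interpret S: nonempty_tree S s by fact
  note inner = nonempty_tree_join[OF P R]
  let ?T = "join (join P R) S"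
  note below = trancl_join_root[OF inner S] trancl_join_lnode[OF inner S] trancl_join_rnode[OF inner S]
    trancl_join_root[OF P R] trancl_join_lnode[OF P R] trancl_join_rnode[OF P R]
  have verts: "(parcs P)\<^sup>+ `` {u} \<subseteq> pverts P" "(parcs R)\<^sup>+ `` {u} \<subseteq> pverts R"
    "(parcs S)\<^sup>+ `` {u} \<subseteq> pverts S" for u
    by (auto simp only: Image_singleton_iff dest: P.trancl_verts R.trancl_verts S.trancl_verts)
  show ?thesis
    unfolding tree_T1_def
  \<comment> \<open>Goals follow the order of the locale assumptions: 8 to 12 concern descendants of
    the root, of the fork and of the nodes in the three components, 13 the top of the outer
    component.\<close>
  proof (unfold_locales, goal_cases)
    case (13)
    show ?case
    proof (rule bexI[of _ "rnode s"])
      show "rnode s \<in> rnode ` pverts S" using S.root_in_verts by simp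
      have top: "(parcs S)\<^sup>+ `` {s} = pverts S - {s}"
        by (rule set_eqI) (simp only: Image_singleton_iff S.root_trancl_iff)
      show "(parcs ?T)\<^sup>+ `` {rnode s} \<inter> pverts ?T = rnode ` pverts S - {rnode s}"
        unfolding below top by auto
    qed
  next
    case 8
    show ?case unfolding below by auto
  next
    case 9
    show ?case unfolding below by auto
  next
    case (10 x)
    then obtain v where x: "x = lnode (lnode v)" by blast
    show ?case unfolding x below using verts[of v] by blast
  next
    case (11 x)
    then obtain v where x: "x = lnode (rnode v)" by blast
    show ?case unfolding x below using verts[of v] by blast
  next
    case (12 x)
    then obtain v where x: "x = rnode v" by blast
    show ?case unfolding x below using verts[of v] by blast
  qed auto
qed

text \<open>Now the fork is $z$, coded \<open>rnode 0\<close>, and the outer component is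
  \<open>P\<close>.\<close>

lemma nested_fork_T2:
  assumes P: "nonempty_tree P p" and R: "nonempty_tree R r" and S: "nonempty_tree S s"
  shows "nested_fork ((parcs (tree_T2 P R S))\<^sup>+) (pverts (tree_T2 P R S)) 0 (rnode 0)
    (rnode ` lnode ` pverts R) (rnode ` rnode ` pverts S) (lnode ` pverts P)"
proof -
  interpret P: nonempty_tree P p by fact
  interpret R: nonempty_tree R r by fact
  interpret S: nonempty_tree S s by fact
  note inner = nonempty_tree_join[OF R S]
  let ?T = "join P (join R S)"
  note below = trancl_join_root[OF P inner] trancl_join_lnode[OF P inner] trancl_join_rnode[OF P inner]
    trancl_join_root[OF R S] trancl_join_lnode[OF R S] trancl_join_rnode[OF R S]
  have verts: "(parcs P)\<^sup>+ `` {u} \<subseteq> pverts P" "(parcs R)\<^sup>+ `` {u} \<subseteq> pverts R"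
    "(parcs S)\<^sup>+ `` {u} \<subseteq> pverts S" for u
    by (auto simp only: Image_singleton_iff dest: P.trancl_verts R.trancl_verts S.trancl_verts)
  show ?thesis
    unfolding tree_T2_def
  proof (unfold_locales, goal_cases)
    case (13)
    show ?case
    proof (rule bexI[of _ "lnode p"])
      show "lnode p \<in> lnode ` pverts P" using P.root_in_verts by simp
      have top: "(parcs P)\<^sup>+ `` {p} = pverts P - {p}"
        by (rule set_eqI) (simp only: Image_singleton_iff P.root_trancl_iff)
      show "(parcs ?T)\<^sup>+ `` {lnode p} \<inter> pverts ?T = lnode ` pverts P - {lnode p}"
        unfolding below top by auto
    qed
  next
    case 8
    show ?case unfolding below by auto
  next
    case 9
    show ?case unfolding below by auto
  next
    case (10 x)
    then obtain v where x: "x = rnode (lnode v)" by blast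
    show ?case unfolding x below using verts[of v] by blast
  next
    case (11 x)
    then obtain v where x: "x = rnode (rnode v)" by blast
    show ?case unfolding x below using verts[of v] by blast
  next
    case (12 x)
    then obtain v where x: "x = lnode v" by blast
    show ?case unfolding x below using verts[of v] by blast
  qed auto
qed

section \<open>The two trees of the theorem\<close>

context
  fixes P R S :: ntree and p r s :: nat
  assumes P: "nonempty_tree P p" and R: "nonempty_tree R r" and S: "nonempty_tree S s"
begin

lemma tree_T1: "nonempty_tree (tree_T1 P R S) 0"
  and tree_T2: "nonempty_tree (tree_T2 P R S) 0"
  unfolding tree_T1_def tree_T2_def
  by (rule nonempty_tree_join[OF nonempty_tree_join[OF P R] S])
    (rule nonempty_tree_join[OF P nonempty_tree_join[OF R S]])

lemma tree_size_T1: "tree_size (tree_T1 P R S) = tree_size P + tree_size R + tree_size S + 2"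
  and tree_size_T2: "tree_size (tree_T2 P R S) = tree_size P + tree_size R + tree_size S + 2"
  unfolding tree_T1_def tree_T2_def
  using tree_size_join[OF nonempty_tree_join[OF P R] S] tree_size_join[OF P R]
    tree_size_join[OF P nonempty_tree_join[OF R S]] tree_size_join[OF R S]
  by simp_all

text \<open>Formulated for order embeddings so that it applies twice: to a common supertree, and to
  \<open>tree_T2 P R S\<close> itself when a common minor is too large.\<close>

lemma card_common_order_extension:
  assumes "nonempty_tree U q"
    and sub: "f ` pverts (tree_T1 P R S) \<subseteq> pverts U" "g ` pverts (tree_T2 P R S) \<subseteq> pverts U"
    and inj: "inj_on f (pverts (tree_T1 P R S))" "inj_on g (pverts (tree_T2 P R S))"
    and f: "\<And>u v. u \<in> pverts (tree_T1 P R S) \<Longrightarrow> v \<in> pverts (tree_T1 P R S) \<Longrightarrow>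
      (f u, f v) \<in> (parcs U)\<^sup>+ \<longleftrightarrow> (u, v) \<in> (parcs (tree_T1 P R S))\<^sup>+"
    and g: "\<And>u v. u \<in> pverts (tree_T2 P R S) \<Longrightarrow> v \<in> pverts (tree_T2 P R S) \<Longrightarrow>
      (g u, g v) \<in> (parcs U)\<^sup>+ \<longleftrightarrow> (u, v) \<in> (parcs (tree_T2 P R S))\<^sup>+"
    and sizes: "tree_size P + 2 \<le> tree_size S" "tree_size S < tree_size P + tree_size R"
  shows "tree_size P + tree_size R + tree_size S + 3 < tree_size U"
proof -
  interpret P: nonempty_tree P p by (fact P)
  interpret forest_order "(parcs U)\<^sup>+" "pverts U"
    using assms(1) by (rule nonempty_tree.forest_order)
  have V1: "lnode ` lnode ` pverts P \<union> lnode ` rnode ` pverts R \<union> rnode ` pverts S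
      \<subseteq> pverts (tree_T1 P R S)"
    and V2: "rnode ` lnode ` pverts R \<union> rnode ` rnode ` pverts S \<union> lnode ` pverts P
      \<subseteq> pverts (tree_T2 P R S)"
    unfolding tree_T1_def tree_T2_def by auto
  have card_f: "card (f ` X) = card X" if "X \<subseteq> pverts (tree_T1 P R S)" for X
    using card_image[OF inj_on_subset[OF inj(1) that]] .
  have card_g: "card (g ` X) = card X" if "X \<subseteq> pverts (tree_T2 P R S)" for X
    using card_image[OF inj_on_subset[OF inj(2) that]] .
  have "0 < tree_size P" unfolding tree_size_def using P.pair_finite_verts P.root_in_verts
    by (auto simp: card_gt_0_iff)
  with sizes V1 V2 show ?thesis
    unfolding tree_size_def
    by (intro no_small_common_superorder[OF
        nested_fork_image[OF nested_fork_T1[OF P R S] inj(1) f]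
        nested_fork_image[OF nested_fork_T2[OF P R S] inj(2) g] sub])
      (simp_all add: card_f card_g card_image)
qed

lemma common_supertree_size:
  assumes "common_supertree (tree_T1 P R S) (tree_T2 P R S) U"
    and sizes: "tree_size P + 2 \<le> tree_size S" "tree_size S < tree_size P + tree_size R"
  shows "tree_size (tree_T1 P R S) + 1 < tree_size U"
proof -
  obtain f g where f: "minor_embedding f (tree_T1 P R S) U" and g: "minor_embedding g (tree_T2 P R S) U"
    using assms(1) unfolding common_supertree_def is_minor_def by blast
  then have f': "f ` pverts (tree_T1 P R S) \<subseteq> pverts U" "inj_on f (pverts (tree_T1 P R S))"
    and g': "g ` pverts (tree_T2 P R S) \<subseteq> pverts U" "inj_on g (pverts (tree_T2 P R S))"
    by (simp_all add: minor_embedding_def)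
  then have "pverts U \<noteq> {}" using nonempty_tree.root_in_verts[OF tree_T1] by auto
  with assms(1) obtain q where U: "nonempty_tree U q"
    unfolding common_supertree_def by (elim conjE rooted_tree_nonempty)
  have "tree_size P + tree_size R + tree_size S + 3 < tree_size U"
    by (rule card_common_order_extension[OF U f'(1) g'(1) f'(2) g'(2)
          minor_embedding_trancl_iff[OF tree_T1 U f] minor_embedding_trancl_iff[OF tree_T2 U g] sizes])
  then show ?thesis by (simp add: tree_size_T1)
qed

text \<open>If \<open>M\<close> were as large as $T_1$, the embedding \<open>f\<close> would be
  onto. Inverting it and applying \<open>g\<close> embeds the order of $T_1$ in that of $T_2$,
  making $T_2$ a common extension with too few nodes.\<close>

lemma common_minor_size:
  assumes "common_minor (tree_T1 P R S) (tree_T2 P R S) M"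
    and sizes: "tree_size P + 2 \<le> tree_size S" "tree_size S < tree_size P + tree_size R"
  shows "tree_size M < tree_size (tree_T1 P R S)"
proof (rule ccontr)
  assume large: "\<not> ?thesis"
  interpret T1: nonempty_tree "tree_T1 P R S" 0 by (rule tree_T1)
  obtain f g where f: "minor_embedding f M (tree_T1 P R S)" and g: "minor_embedding g M (tree_T2 P R S)"
    using assms(1) unfolding common_minor_def is_minor_def by blast
  then have f': "f ` pverts M \<subseteq> pverts (tree_T1 P R S)" "inj_on f (pverts M)"
    and g': "g ` pverts M \<subseteq> pverts (tree_T2 P R S)" "inj_on g (pverts M)"
    by (simp_all add: minor_embedding_def)
  have "card (f ` pverts M) = tree_size M" unfolding tree_size_def using f'(2) by (rule card_image)
  then have onto: "f ` pverts M = pverts (tree_T1 P R S)"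
    using large f'(1) T1.pair_finite_verts by (intro card_seteq) (auto simp: tree_size_def)
  then have "pverts M \<noteq> {}" using T1.root_in_verts by auto
  with assms(1) obtain q where M: "nonempty_tree M q"
    unfolding common_minor_def by (elim conjE rooted_tree_nonempty)
  define h where "h = inv_into (pverts M) f"
  have h: "h u \<in> pverts M" "f (h u) = u" if "u \<in> pverts (tree_T1 P R S)" for u
    using that onto unfolding h_def by (auto intro: inv_into_into f_inv_into_f)
  have "tree_size P + tree_size R + tree_size S + 3 < tree_size (tree_T2 P R S)"
  proof (rule card_common_order_extension[OF tree_T2 _ _ _ _ _ _ sizes, of "g \<circ> h" id])
    show "(g \<circ> h) ` pverts (tree_T1 P R S) \<subseteq> pverts (tree_T2 P R S)" using h g' by auto
    show "inj_on (g \<circ> h) (pverts (tree_T1 P R S))"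
      using h g'(2) by (intro inj_onI) (metis comp_apply inj_onD)
    fix u v assume uv: "u \<in> pverts (tree_T1 P R S)" "v \<in> pverts (tree_T1 P R S)"
    show "((g \<circ> h) u, (g \<circ> h) v) \<in> (parcs (tree_T2 P R S))\<^sup>+ \<longleftrightarrow> (u, v) \<in> (parcs (tree_T1 P R S))\<^sup>+"
      using minor_embedding_trancl_iff[OF M tree_T2 g h(1)[OF uv(1)] h(1)[OF uv(2)]]
        minor_embedding_trancl_iff[OF M tree_T1 f h(1)[OF uv(1)] h(1)[OF uv(2)]]
      by (simp add: h(2)[OF uv(1)] h(2)[OF uv(2)])
  qed simp_all
  then show False by (simp add: tree_size_T2)
qed

end

text \<open>\<open>join T1 T2\<close> is a common supertree, so one of least size exists. The
  failure of the size equality needs an actual smallest supertree.\<close>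

lemma ex_smallest_common_supertree:
  assumes "nonempty_tree T1 r1" "nonempty_tree T2 r2"
  shows "\<exists>U. smallest_common_supertree T1 T2 U"
proof -
  have "common_supertree T1 T2 (join T1 T2)"
    using nonempty_tree.rooted_tree[OF nonempty_tree_join[OF assms]] is_minor_join[OF assms]
    unfolding common_supertree_def by blast
  from ex_has_least_nat[of "common_supertree T1 T2", OF this]
  show ?thesis unfolding smallest_common_supertree_def .
qed

section \<open>The example with components of sizes 1, 3 and 3\<close>

definition singleton_tree :: ntree where
  "singleton_tree = \<lparr> pverts = {0}, parcs = {} \<rparr>"

text \<open>Serves as both \<open>R\<close> and \<open>S\<close>, with the single node as
  \<open>P\<close>. The sizes 1, 3, 3 are the least with \<open>0 < p\<close>,
  \<open>p + 2 \<le> s\<close> and \<open>s < p + r\<close>.\<close>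

abbreviation cherry :: ntree where
  "cherry \<equiv> join singleton_tree singleton_tree"

text \<open>Both trees of the example become this one when the node $y$ of the first (coded \<open>1\<close>),
  respectively the node $z$ of the second (coded \<open>2\<close>), is contracted into the root. The node names
  are those of the first tree.\<close>

definition contracted_tree :: ntree where
  "contracted_tree = \<lparr> pverts = {0, 2, 3, 4, 5, 6, 9, 13},
     parcs = {(0, 2), (0, 3), (0, 5), (2, 4), (2, 6), (5, 9), (5, 13)} \<rparr>"

lemma nonempty_singleton_tree: "nonempty_tree singleton_tree 0"
  by unfold_locales (auto simp: singleton_tree_def intro: single_valuedI)

lemma nonempty_contracted_tree: "nonempty_tree contracted_tree 0"
proof
  fix v assume v: "v \<in> pverts contracted_tree"
  have arc: "(0, v) \<in> (parcs contracted_tree)\<^sup>*" if "(0, v) \<in> parcs contracted_tree" for v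
    using that by (rule r_into_rtrancl)
  have arcs: "(0, v) \<in> (parcs contracted_tree)\<^sup>*"
    if "(0, u) \<in> parcs contracted_tree" "(u, v) \<in> parcs contracted_tree" for u v
    using that by (rule rtrancl_trans[OF r_into_rtrancl r_into_rtrancl])
  from v consider "v = 0" | "v \<in> {2, 3, 5}" | "v \<in> {4, 6}" | "v \<in> {9, 13}"
    by (auto simp: contracted_tree_def)
  then show "(0, v) \<in> (parcs contracted_tree)\<^sup>*"
  proof cases
    case 2
    show ?thesis by (rule arc) (use 2 in \<open>auto simp: contracted_tree_def\<close>)
  next
    case 3
    show ?thesis by (rule arcs[of 2]) (use 3 in \<open>auto simp: contracted_tree_def\<close>)
  next
    case 4
    show ?thesis by (rule arcs[of 5]) (use 4 in \<open>auto simp: contracted_tree_def\<close>)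
  qed simp
qed (auto simp: contracted_tree_def intro!: single_valuedI)

lemma singleton_tree_simps: "parcs singleton_tree = {}" "pverts singleton_tree = {0}"
  by (simp_all add: singleton_tree_def)

lemma tree_root_eqs:
  "tree_root singleton_tree = 0" "tree_root cherry = 0"
  "tree_root (join singleton_tree cherry) = 0" "tree_root (join cherry cherry) = 0"
  by (rule nonempty_tree.tree_root_eq, (rule nonempty_tree_join nonempty_singleton_tree)+)+

lemma example_T1:
  "pverts (tree_T1 singleton_tree cherry cherry) = {0, 1, 2, 3, 4, 5, 6, 9, 13}"
  "parcs (tree_T1 singleton_tree cherry cherry) =
     {(0, 1), (0, 2), (1, 3), (1, 5), (5, 9), (5, 13), (2, 4), (2, 6)}"
  unfolding tree_T1_def pverts_join parcs_join tree_root_eqs singleton_tree_simps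
  by (simp_all add: lnode_def rnode_def insert_commute numeral_2_eq_2[symmetric])

lemma example_T2:
  "pverts (tree_T2 singleton_tree cherry cherry) = {0, 1, 2, 4, 6, 8, 10, 12, 14}"
  "parcs (tree_T2 singleton_tree cherry cherry) =
     {(0, 1), (0, 2), (2, 4), (2, 6), (4, 8), (4, 12), (6, 10), (6, 14)}"
  unfolding tree_T2_def pverts_join parcs_join tree_root_eqs singleton_tree_simps
  by (simp_all add: lnode_def rnode_def insert_commute numeral_2_eq_2[symmetric])

lemma contracted_tree_common_minor:
  "common_minor (tree_T1 singleton_tree cherry cherry) (tree_T2 singleton_tree cherry cherry) contracted_tree"
proof -
  note L = nonempty_singleton_tree
  note C = nonempty_tree_join[OF L L]
  interpret T1: nonempty_tree "tree_T1 singleton_tree cherry cherry" 0 by (rule tree_T1[OF L C C])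
  interpret T2: nonempty_tree "tree_T2 singleton_tree cherry cherry" 0 by (rule tree_T2[OF L C C])
  have "is_minor contracted_tree (tree_T1 singleton_tree cherry cherry)"
    \<comment> \<open>Only the arcs from 0 to 3 and to 5 become longer paths; both run through the
      omitted node 1.\<close>
    by (rule is_minorI[of id]) (auto simp: contracted_tree_def example_T1 T1.pair_wf_digraph)
  moreover have "is_minor contracted_tree (tree_T2 singleton_tree cherry cherry)"
    \<comment> \<open>The leaf 3 goes to the copy of \<open>P\<close>, the cherry at 5 to that of
      \<open>R\<close> and the cherry at 2 to that of \<open>S\<close>. The omitted node 2 of the
      second tree lies on the paths from 0 to 4 and to 6.\<close>
    by (rule is_minorI[of "id(3 := 1, 5 := 4, 9 := 8, 13 := 12, 2 := 6, 4 := 10, 6 := 14)"])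
      (auto simp: contracted_tree_def example_T2 T2.pair_wf_digraph)
  ultimately show ?thesis
    unfolding common_minor_def using nonempty_tree.rooted_tree[OF nonempty_contracted_tree] by blast
qed

text \<open>Separates \<open>P\<close> from \<open>S\<close> in the example by their sizes.\<close>

lemma digraph_iso_tree_size:
  assumes "digraph_iso (with_proj A) (with_proj B)"
  shows "tree_size A = tree_size B"
proof -
  obtain h where "pre_digraph.digraph_isomorphism (with_proj A) h" "with_proj B = app_iso h (with_proj A)"
    using assms unfolding digraph_iso_def by blast
  then have "inj_on (iso_verts h) (pverts A)" "verts (with_proj B) = iso_verts h ` pverts A"
    by (simp_all add: pre_digraph.digraph_isomorphism_def)
  then show ?thesis by (simp add: tree_size_def card_image)
qed

theorem mainTheorem1:
  shows "(\<exists>P R S :: ntree.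
      rooted_tree P \<and> pverts P \<noteq> {} \<and>
      rooted_tree R \<and> pverts R \<noteq> {} \<and>
      rooted_tree S \<and> pverts S \<noteq> {} \<and>
      \<not> digraph_iso (with_proj P) (with_proj S) \<and>
      (\<forall>M. largest_common_minor (tree_T1 P R S) (tree_T2 P R S) M \<longrightarrow>
         int (tree_size M) = int (tree_size (tree_T1 P R S)) - 1) \<and>
      (\<forall>U. smallest_common_supertree (tree_T1 P R S) (tree_T2 P R S) U \<longrightarrow>
         tree_size U > tree_size (tree_T1 P R S) + 1))
    \<and> \<not> (\<forall>T1 T2 :: ntree. rooted_tree T1 \<and> rooted_tree T2 \<longrightarrow>
         (\<forall>M U. largest_common_minor T1 T2 M \<and> smallest_common_supertree T1 T2 U \<longrightarrow>
            int (tree_size U) = int (tree_size T1) + int (tree_size T2) - int (tree_size M)))"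
proof -
  note L = nonempty_singleton_tree
  note C = nonempty_tree_join[OF L L]
  let ?T1 = "tree_T1 singleton_tree cherry cherry" and ?T2 = "tree_T2 singleton_tree cherry cherry"
  have sL: "tree_size singleton_tree = 1" by (simp add: tree_size_def singleton_tree_def)
  have sC: "tree_size cherry = 3" using tree_size_join[OF L L] sL by simp
  have s1: "tree_size ?T1 = 9" and s2: "tree_size ?T2 = 9"
    using tree_size_T1[OF L C C] tree_size_T2[OF L C C] sL sC by simp_all
  have sM: "tree_size contracted_tree = 8" by (simp add: tree_size_def contracted_tree_def)
  have minor: "tree_size M < 9" if "common_minor ?T1 ?T2 M" for M
    using common_minor_size[OF L C C that] sL sC s1 by simp
  have super: "10 < tree_size U" if "common_supertree ?T1 ?T2 U" for U
    using common_supertree_size[OF L C C that] sL sC s1 by simp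
  have largest: "tree_size M = 8" if "largest_common_minor ?T1 ?T2 M" for M
  proof -
    have "tree_size M < 9" using that minor unfolding largest_common_minor_def by blast
    moreover have "tree_size contracted_tree \<le> tree_size M"
      using that contracted_tree_common_minor unfolding largest_common_minor_def by blast
    ultimately show ?thesis using sM by simp
  qed
  have ex_largest: "largest_common_minor ?T1 ?T2 contracted_tree"
    unfolding largest_common_minor_def
    using contracted_tree_common_minor minor sM by fastforce
  have smallest: "10 < tree_size U" if "smallest_common_supertree ?T1 ?T2 U" for U
    using that super unfolding smallest_common_supertree_def by blast
  obtain U where U: "smallest_common_supertree ?T1 ?T2 U"
    using ex_smallest_common_supertree[OF tree_T1[OF L C C] tree_T2[OF L C C]] by blast
  have trees: "rooted_tree singleton_tree" "rooted_tree cherry" "rooted_tree ?T1" "rooted_tree ?T2"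
    using L C tree_T1[OF L C C] tree_T2[OF L C C] by (auto intro: nonempty_tree.rooted_tree)
  have "\<not> digraph_iso (with_proj singleton_tree) (with_proj cherry)"
    using digraph_iso_tree_size[of singleton_tree cherry] sL sC by auto
  then have example: "rooted_tree singleton_tree \<and> pverts singleton_tree \<noteq> {} \<and>
      rooted_tree cherry \<and> pverts cherry \<noteq> {} \<and> rooted_tree cherry \<and> pverts cherry \<noteq> {} \<and>
      \<not> digraph_iso (with_proj singleton_tree) (with_proj cherry) \<and>
      (\<forall>M. largest_common_minor ?T1 ?T2 M \<longrightarrow> int (tree_size M) = int (tree_size ?T1) - 1) \<and>
      (\<forall>U. smallest_common_supertree ?T1 ?T2 U \<longrightarrow> tree_size U > tree_size ?T1 + 1)"
    using trees(1,2) largest smallest s1 by (simp add: singleton_tree_simps)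
  \<comment> \<open>The equality would require size 9 + 9 - 8 = 10, but common supertrees have more
    than 10 nodes.\<close>
  have "int (tree_size U) \<noteq> int (tree_size ?T1) + int (tree_size ?T2) - int (tree_size contracted_tree)"
    using smallest[OF U] s1 s2 sM by simp
  then have "\<not> (\<forall>T1 T2 :: ntree. rooted_tree T1 \<and> rooted_tree T2 \<longrightarrow>
      (\<forall>M U. largest_common_minor T1 T2 M \<and> smallest_common_supertree T1 T2 U \<longrightarrow>
        int (tree_size U) = int (tree_size T1) + int (tree_size T2) - int (tree_size M)))"
    using trees(3,4) ex_largest U by meson
  with example show ?thesis
    by (intro conjI[OF exI[of _ singleton_tree, OF exI[of _ cherry, OF exI[of _ cherry]]]])
qed

end
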